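(* The minimum density of a $2$-identifying code of the square grid $G_S$ is at least $3/19$; that is, every $2$-identifying code $C$ of $G_S$ satisfies $D(C)\ge \frac{3}{19}$.
   Context: The square grid $G_S$ is the graph with vertex set $V(G_S)=\mathbb{Z}\times\mathbb{Z}$ and edge set $E(G_S)=\{\{u,v\}: u-v\in\{(0,\pm1),(\pm1,0)\}\}$, subtraction being coordinatewise. For a connected undirected graph $G$ with graph distance $d$, $B_r(v)=\{u\in V(G): d(u,v)\le r\}$. A set $C\subseteq V(G)$ is an $r$-identifying code of $G$ if (1) $B_r(v)\cap C\ne\emptyset$ for every $v\in V(G)$, and (2) $B_r(u)\cap C\neq B_r(v)\cap C$ for all $u\ne v$ in $V(G)$. For a code $C$ in a graph with vertex set $\mathbb{Z}\times\mathbb{Z}$, let $Q_m=\{(x,y)\in\mathbb{Z}\times\mathbb{Z}: |x|\le m,\ |y|\le m\}$; the density of $C$ is $D(C)=\limsup_{m\to\infty}\frac{|C\cap Q_m|}{|Q_m|}$. *)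

theory Defs
  imports
    "Graph_Theory.Shortest_Path"
    "Graph_Theory.Pair_Digraph"
    "Graph_Theory.Digraph_Component"
    "HOL-Library.Product_Plus"
    "HOL-Library.Liminf_Limsup"
    "HOL-Library.Extended_Real"
begin

text \<open>
  An undirected graph is a symmetric digraph: the edge between \<open>u\<close> and \<open>v\<close> is the pair of
  arcs \<open>(u, v)\<close> and \<open>(v, u)\<close>.
\<close>

definition square_grid :: "(int \<times> int) pair_pre_digraph" where
  "square_grid =
     \<lparr> pverts = UNIV,
       parcs = {(u, v). u - v \<in> {(0, 1), (0, -1), (1, 0), (-1, 0)}} \<rparr>"

interpretation square_grid: sym_digraph "with_proj square_grid"
proof
  show "symmetric (with_proj square_grid)"
    unfolding symmetric_def arcs_ends_def arc_to_ends_def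
    by (rule symI) (auto simp: square_grid_def)
qed (auto simp: square_grid_def)

text \<open>
  With unit arc weights the cost of a walk is its number of arcs, so the constant \<open>\<mu>\<close> of
  locale \<open>wf_digraph\<close> is the graph distance, with value \<open>\<infinity>\<close> between distinct components.
\<close>

definition graph_dist :: "('a, 'b) pre_digraph \<Rightarrow> 'a \<Rightarrow> 'a \<Rightarrow> ereal" where
  "graph_dist G u v = wf_digraph.\<mu> G (\<lambda>_. 1) u v"

definition graph_ball :: "('a, 'b) pre_digraph \<Rightarrow> nat \<Rightarrow> 'a \<Rightarrow> 'a set" where
  "graph_ball G r v = {u \<in> verts G. graph_dist G u v \<le> ereal (real r)}"

definition identifying_code :: "('a, 'b) pre_digraph \<Rightarrow> nat \<Rightarrow> 'a set \<Rightarrow> bool" where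
  "identifying_code G r C \<longleftrightarrow>
     C \<subseteq> verts G \<and>
     (\<forall>v \<in> verts G. graph_ball G r v \<inter> C \<noteq> {}) \<and>
     (\<forall>u \<in> verts G. \<forall>v \<in> verts G. u \<noteq> v \<longrightarrow> graph_ball G r u \<inter> C \<noteq> graph_ball G r v \<inter> C)"

definition grid_square :: "nat \<Rightarrow> (int \<times> int) set" where
  "grid_square m = {(x, y). \<bar>x\<bar> \<le> int m \<and> \<bar>y\<bar> \<le> int m}"

definition code_density :: "(int \<times> int) set \<Rightarrow> ereal" where
  "code_density C = limsup (\<lambda>m. ereal (real (card (C \<inter> grid_square m)) / real (card (grid_square m))))"

end

theory Submission
  imports Defs "HOL-Real_Asymp.Real_Asymp"
begin

text \<open>
  Let \<open>I v\<close> be the set of codewords within distance 2 of \<open>v\<close>.  At most one vertex per codeword has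
  \<open>card (I v) = 1\<close>.  If \<open>P\<close> is the set of vertices \<open>v\<close> near a codeword \<open>c\<close> with \<open>I v = {c, w v}\<close>,
  then the sets \<open>I v\<close> being distinct, the ball around \<open>w v\<close> meets \<open>P\<close> in \<open>v\<close> only; a case
  distinction shows that such a \<open>P\<close> has at most 8 elements.  So there are at most 4 vertices
  with \<open>card (I v) = 2\<close> per codeword.  As balls have 13 elements, double counting the pairs
  \<open>(v, c)\<close> with \<open>c \<in> I v\<close> over \<open>n\<close> vertices and \<open>k\<close> codewords gives \<open>13 k \<ge> 3 n - 2 k - 4 k\<close>.
\<close>

section \<open>Balls of the square grid\<close>

lemma pverts_square_grid: "pverts square_grid = UNIV"
  by (simp add: square_grid_def)

lemma mem_parcs_square_grid:
  "(u, v) \<in> parcs square_grid \<longleftrightarrow> u - v \<in> {(0, 1), (0, - 1), (1, 0), (- 1, 0)}"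
  by (simp add: square_grid_def)

text \<open>Each arc changes exactly one coordinate, by one, so the triangle inequality adds up
  along the walk.\<close>

lemma square_grid_awalk_length_ge:
  assumes "square_grid.awalk u p v"
  shows "\<bar>fst u - fst v\<bar> + \<bar>snd u - snd v\<bar> \<le> int (length p)"
  using assms
proof (induction p arbitrary: u)
  case Nil
  then show ?case by (simp add: square_grid.awalk_Nil_iff)
next
  case (Cons e p)
  obtain x where e: "e = (u, x)" and ux: "u - x \<in> {(0, 1), (0, - 1), (1, 0), (- 1, 0)}"
    and p: "square_grid.awalk x p v"
    using Cons.prems
    by (cases e) (auto simp: square_grid.awalk_Cons_iff mem_parcs_square_grid)
  have "\<bar>fst u - fst x\<bar> + \<bar>snd u - snd x\<bar> = 1"
    using ux by (cases u; cases x) auto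
  then show ?case using Cons.IH[OF p] by simp
qed

lemma square_grid_awalk_exists:
  assumes "\<bar>fst u - fst v\<bar> + \<bar>snd u - snd v\<bar> = int n"
  shows "\<exists>p. square_grid.awalk u p v \<and> length p = n"
  using assms
proof (induction n arbitrary: u)
  case 0
  then have "u = v" by (auto simp: prod_eq_iff)
  then show ?case by (auto simp: square_grid.awalk_Nil_iff pverts_square_grid)
next
  case (Suc n)
  \<comment> \<open>The first step of a shortest walk: the first coordinate is corrected before the
    second, and \<open>sgn\<close> gives the direction.\<close>
  define x where "x = (if fst u \<noteq> fst v then (fst u - sgn (fst u - fst v), snd u)
    else (fst u, snd u - sgn (snd u - snd v)))"
  have "\<bar>fst x - fst v\<bar> + \<bar>snd x - snd v\<bar> = int n"
    using Suc.prems by (auto simp: x_def sgn_if)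
  then obtain p where "square_grid.awalk x p v" "length p = n"
    using Suc.IH by blast
  moreover have "u - x \<in> {(0, 1), (0, - 1), (1, 0), (- 1, 0)}"
    using Suc.prems by (cases u; cases v) (auto simp: x_def sgn_if)
  ultimately have "square_grid.awalk u ((u, x) # p) v \<and> length ((u, x) # p) = Suc n"
    by (simp add: square_grid.awalk_Cons_iff mem_parcs_square_grid)
  then show ?case by blast
qed

text \<open>The infimum \<open>\<mu>\<close> over walks is bounded below by the taxicab distance and
  attained by the walk constructed above.\<close>

lemma square_grid_dist:
  "graph_dist (with_proj square_grid) u v = ereal (real_of_int (\<bar>fst u - fst v\<bar> + \<bar>snd u - snd v\<bar>))"
proof -
  define n where "n = nat (\<bar>fst u - fst v\<bar> + \<bar>snd u - snd v\<bar>)"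
  have n: "\<bar>fst u - fst v\<bar> + \<bar>snd u - snd v\<bar> = int n" by (simp add: n_def)
  have cost: "square_grid.awalk_cost (\<lambda>_. 1) p = real (length p)" for p
    by (simp add: square_grid.awalk_cost_def sum_list_triv)
  obtain p where p: "square_grid.awalk u p v" "length p = n"
    using square_grid_awalk_exists[OF n] by blast
  have "square_grid.\<mu> (\<lambda>_. 1) u v = ereal (real n)"
  proof (rule antisym)
    show "square_grid.\<mu> (\<lambda>_. 1) u v \<le> ereal (real n)"
      using square_grid.min_cost_le_walk_cost[OF p(1), of "\<lambda>_. 1"] p(2) by (simp add: cost)
    show "ereal (real n) \<le> square_grid.\<mu> (\<lambda>_. 1) u v"
      unfolding square_grid.\<mu>_def cost
      using square_grid_awalk_length_ge[of u _ v] n by (intro INF_greatest) auto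
  qed
  then show ?thesis by (simp only: graph_dist_def n of_int_of_nat_eq)
qed

definition diamond :: "int \<times> int \<Rightarrow> (int \<times> int) set" where
  "diamond v = {u. \<bar>fst u - fst v\<bar> + \<bar>snd u - snd v\<bar> \<le> 2}"

lemma graph_ball_square_grid: "graph_ball (with_proj square_grid) 2 v = diamond v"
  by (auto simp: graph_ball_def diamond_def square_grid_dist pverts_square_grid)

lemma mem_diamond_commute: "u \<in> diamond v \<longleftrightarrow> v \<in> diamond u"
  by (auto simp: diamond_def)

lemma diff_mem_diamond_diff: "u - c \<in> diamond (v - c) \<longleftrightarrow> u \<in> diamond v"
  by (simp add: diamond_def)

text \<open>The list form makes membership decidable by simplification and, its entries being
  distinct, yields cardinalities and sums over the ball.\<close>

lemma diamond_eq:
  "diamond (a, b) = set [(a, b), (a + 1, b), (a - 1, b), (a, b + 1), (a, b - 1), (a + 2, b), (a - 2, b),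
     (a, b + 2), (a, b - 2), (a + 1, b + 1), (a + 1, b - 1), (a - 1, b + 1), (a - 1, b - 1)]"
  (is "_ = ?S")
proof -
  have "(a + i, b + j) \<in> ?S" if ij: "\<bar>i\<bar> + \<bar>j\<bar> \<le> 2" for i j :: int
  proof -
    have "i = -2 \<or> i = -1 \<or> i = 0 \<or> i = 1 \<or> i = 2" "j = -2 \<or> j = -1 \<or> j = 0 \<or> j = 1 \<or> j = 2"
      using ij by linarith+
    then show ?thesis by (elim disjE) (use ij in simp_all)
  qed
  from this[of "_ - a" "_ - b"] have "diamond (a, b) \<subseteq> ?S"
    by (auto simp: diamond_def simp del: list.set)
  moreover have "?S \<subseteq> diamond (a, b)" by (simp add: diamond_def)
  ultimately show ?thesis by (rule subset_antisym)
qed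

lemma finite_diamond: "finite (diamond v)"
  by (cases v) (simp add: diamond_eq)

lemma card_diamond: "card (diamond v) = 13"
proof -
  obtain a b where v: "v = (a, b)" by (cases v)
  show ?thesis unfolding v diamond_eq by (subst distinct_card) simp_all
qed

section \<open>Vertices that see exactly two codewords\<close>

text \<open>
  The vertices of a ball are grouped by symmetry: the centre \<open>c\<close>, the four arms (\<open>(1, 0)\<close> and
  \<open>(2, 0)\<close> for \<open>aE\<close>, and so on), and the diagonal points \<open>d1\<close> to \<open>d4\<close>, counterclockwise
  from \<open>(1, 1)\<close>.
\<close>

lemma arm_sum_le:
  fixes c :: int
  assumes "0 \<le> c" "c \<le> 1" "0 \<le> aE" "aE \<le> 2" "0 \<le> aW" "aW \<le> 2" "0 \<le> aN" "aN \<le> 2" "0 \<le> aS" "aS \<le> 2"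
    "0 \<le> d1" "d1 \<le> 1" "0 \<le> d2" "d2 \<le> 1" "0 \<le> d3" "d3 \<le> 1" "0 \<le> d4" "d4 \<le> 1"
    "c = 0 \<or> aE + d1 + d4 = 0 \<or> aN + d1 + d2 = 0 \<or> aW + d2 + d3 = 0 \<or> aS + d3 + d4 = 0"
    "aE \<le> 1 \<or> aN + d1 = 0 \<or> aS + d4 = 0 \<or> c + aW = 0 \<and> aN \<le> 1 \<and> aS \<le> 1"
    "aW \<le> 1 \<or> aN + d2 = 0 \<or> aS + d3 = 0 \<or> c + aE = 0 \<and> aN \<le> 1 \<and> aS \<le> 1"
    "aN \<le> 1 \<or> aE + d1 = 0 \<or> aW + d2 = 0 \<or> c + aS = 0 \<and> aE \<le> 1 \<and> aW \<le> 1"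
    "aS \<le> 1 \<or> aE + d4 = 0 \<or> aW + d3 = 0 \<or> c + aN = 0 \<and> aE \<le> 1 \<and> aW \<le> 1"
  shows "c + aE + aW + aN + aS + d1 + d2 + d3 + d4 \<le> 8"
  \<comment> \<open>If all arms are at most 1, the sum is at most 8 when \<open>c = 0\<close> and at
    most 9 - 3 when \<open>c = 1\<close>. Let \<open>aE = 2\<close>. If centre and opposite arm
    vanish, the bound is 2 + 1 + 1 + 4. If \<open>aN = d1 = 0\<close>, at most 10 remains: two other
    arms of at most 1 lose 2, \<open>aS = 2\<close> forces \<open>aW = d3 = 0\<close>, and
    \<open>aW = 2\<close> with \<open>aS \<le> 1\<close> loses \<open>d2\<close> or
    \<open>aS + d3\<close>. The rest is symmetric.\<close>
  using assms by (smt (verit))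

text \<open>Here a codeword sits at the origin and \<open>w\<close> is the other codeword seen from
  \<open>v\<close>. Balls around such \<open>w\<close> overlap the ball at the origin so much that
  isolating the centre or an inner arm point empties whole groups of points.\<close>

lemma card_isolated_le:
  assumes P: "P \<subseteq> diamond (0, 0)"
    and isol: "\<And>v. v \<in> P \<Longrightarrow> \<exists>w. w \<noteq> (0, 0) \<and> diamond w \<inter> P = {v}"
  shows "card P \<le> 8"
proof -
  \<comment> \<open>Since \<open>v\<close> lies in the ball around \<open>w\<close>, only 13
    candidates for \<open>w\<close> have to be inspected.\<close>
  have iso: "\<exists>w \<in> diamond v. w \<noteq> (0, 0) \<and> (\<forall>u \<in> diamond w. u \<noteq> v \<longrightarrow> u \<notin> P)" if v: "v \<in> P" for v
  proof -
    obtain w where w: "w \<noteq> (0, 0)" "diamond w \<inter> P = {v}"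
      using isol[OF v] by auto
    then have "w \<in> diamond v" by (subst mem_diamond_commute) blast
    with w show ?thesis by blast
  qed
  \<comment> \<open>The ball of every candidate other than the origin contains a whole arm and the
    two diagonal points beside it.\<close>
  have centre: "(0, 0) \<notin> P
    \<or> (1, 0) \<notin> P \<and> (2, 0) \<notin> P \<and> (1, 1) \<notin> P \<and> (1, - 1) \<notin> P
    \<or> (0, 1) \<notin> P \<and> (0, 2) \<notin> P \<and> (1, 1) \<notin> P \<and> (- 1, 1) \<notin> P
    \<or> (- 1, 0) \<notin> P \<and> (- 2, 0) \<notin> P \<and> (- 1, 1) \<notin> P \<and> (- 1, - 1) \<notin> P
    \<or> (0, - 1) \<notin> P \<and> (0, - 2) \<notin> P \<and> (- 1, - 1) \<notin> P \<and> (1, - 1) \<notin> P"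
    using iso[of "(0, 0)"] by (simp add: diamond_eq) blast
  \<comment> \<open>A witness for \<open>(1, 0)\<close> whose ball avoids \<open>(2, 0)\<close> is
    \<open>(0, 1)\<close>, \<open>(1, 2)\<close>, a mirror image of these, or
    \<open>(-1, 0)\<close>; the last one gives the last alternative.\<close>
  have east: "(1, 0) \<notin> P \<or> (2, 0) \<notin> P
    \<or> (0, 1) \<notin> P \<and> (0, 2) \<notin> P \<and> (1, 1) \<notin> P
    \<or> (0, - 1) \<notin> P \<and> (0, - 2) \<notin> P \<and> (1, - 1) \<notin> P
    \<or> (0, 0) \<notin> P \<and> (- 1, 0) \<notin> P \<and> (- 2, 0) \<notin> P \<and> (0, 1) \<notin> P \<and> (0, - 1) \<notin> P"
    using iso[of "(1, 0)"] by (simp add: diamond_eq) blast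
  have west: "(- 1, 0) \<notin> P \<or> (- 2, 0) \<notin> P
    \<or> (0, 1) \<notin> P \<and> (0, 2) \<notin> P \<and> (- 1, 1) \<notin> P
    \<or> (0, - 1) \<notin> P \<and> (0, - 2) \<notin> P \<and> (- 1, - 1) \<notin> P
    \<or> (0, 0) \<notin> P \<and> (1, 0) \<notin> P \<and> (2, 0) \<notin> P \<and> (0, 1) \<notin> P \<and> (0, - 1) \<notin> P"
    using iso[of "(- 1, 0)"] by (simp add: diamond_eq) blast
  have north: "(0, 1) \<notin> P \<or> (0, 2) \<notin> P
    \<or> (1, 0) \<notin> P \<and> (2, 0) \<notin> P \<and> (1, 1) \<notin> P
    \<or> (- 1, 0) \<notin> P \<and> (- 2, 0) \<notin> P \<and> (- 1, 1) \<notin> P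
    \<or> (0, 0) \<notin> P \<and> (0, - 1) \<notin> P \<and> (0, - 2) \<notin> P \<and> (1, 0) \<notin> P \<and> (- 1, 0) \<notin> P"
    using iso[of "(0, 1)"] by (simp add: diamond_eq) blast
  have south: "(0, - 1) \<notin> P \<or> (0, - 2) \<notin> P
    \<or> (1, 0) \<notin> P \<and> (2, 0) \<notin> P \<and> (1, - 1) \<notin> P
    \<or> (- 1, 0) \<notin> P \<and> (- 2, 0) \<notin> P \<and> (- 1, - 1) \<notin> P
    \<or> (0, 0) \<notin> P \<and> (0, 1) \<notin> P \<and> (0, 2) \<notin> P \<and> (1, 0) \<notin> P \<and> (- 1, 0) \<notin> P"
    using iso[of "(0, - 1)"] by (simp add: diamond_eq) blast
  \<comment> \<open>The integer indicator of \<open>P\<close> turns the case distinctions into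
    linear arithmetic; a missing inner point bounds its arm by 1.\<close>
  define q :: "int \<times> int \<Rightarrow> int" where "q v = of_bool (v \<in> P)" for v
  have q0: "0 \<le> q v" and q1: "q v \<le> 1" and q_out: "v \<notin> P \<Longrightarrow> q v = 0" for v
    by (simp_all add: q_def)
  have q2: "q u + q v \<le> 2" and q2': "0 \<le> q u + q v" for u v
    using q0[of u] q0[of v] q1[of u] q1[of v] by linarith+
  have centre': "q (0, 0) = 0 \<or> q (1, 0) + q (2, 0) + q (1, 1) + q (1, - 1) = 0
    \<or> q (0, 1) + q (0, 2) + q (1, 1) + q (- 1, 1) = 0
    \<or> q (- 1, 0) + q (- 2, 0) + q (- 1, 1) + q (- 1, - 1) = 0
    \<or> q (0, - 1) + q (0, - 2) + q (- 1, - 1) + q (1, - 1) = 0"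
    using centre by (elim disjE conjE) (simp_all add: q_out)
  have east': "q (1, 0) + q (2, 0) \<le> 1
    \<or> q (0, 1) + q (0, 2) + q (1, 1) = 0
    \<or> q (0, - 1) + q (0, - 2) + q (1, - 1) = 0
    \<or> q (0, 0) + (q (- 1, 0) + q (- 2, 0)) = 0
      \<and> q (0, 1) + q (0, 2) \<le> 1 \<and> q (0, - 1) + q (0, - 2) \<le> 1"
    using east by (elim disjE conjE) (simp_all add: q_out q1)
  have west': "q (- 1, 0) + q (- 2, 0) \<le> 1
    \<or> q (0, 1) + q (0, 2) + q (- 1, 1) = 0
    \<or> q (0, - 1) + q (0, - 2) + q (- 1, - 1) = 0
    \<or> q (0, 0) + (q (1, 0) + q (2, 0)) = 0
      \<and> q (0, 1) + q (0, 2) \<le> 1 \<and> q (0, - 1) + q (0, - 2) \<le> 1"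
    using west by (elim disjE conjE) (simp_all add: q_out q1)
  have north': "q (0, 1) + q (0, 2) \<le> 1
    \<or> q (1, 0) + q (2, 0) + q (1, 1) = 0
    \<or> q (- 1, 0) + q (- 2, 0) + q (- 1, 1) = 0
    \<or> q (0, 0) + (q (0, - 1) + q (0, - 2)) = 0
      \<and> q (1, 0) + q (2, 0) \<le> 1 \<and> q (- 1, 0) + q (- 2, 0) \<le> 1"
    using north by (elim disjE conjE) (simp_all add: q_out q1)
  have south': "q (0, - 1) + q (0, - 2) \<le> 1
    \<or> q (1, 0) + q (2, 0) + q (1, - 1) = 0
    \<or> q (- 1, 0) + q (- 2, 0) + q (- 1, - 1) = 0
    \<or> q (0, 0) + (q (0, 1) + q (0, 2)) = 0
      \<and> q (1, 0) + q (2, 0) \<le> 1 \<and> q (- 1, 0) + q (- 2, 0) \<le> 1"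
    using south by (elim disjE conjE) (simp_all add: q_out q1)
  have "int (card P) = (\<Sum>v\<in>diamond (0, 0). q v)"
    using P by (simp add: q_def of_bool_def sum.If_cases finite_diamond Int_absorb1)
  also have "\<dots> = q (0, 0) + (q (1, 0) + q (2, 0)) + (q (- 1, 0) + q (- 2, 0)) + (q (0, 1) + q (0, 2))
     + (q (0, - 1) + q (0, - 2)) + q (1, 1) + q (- 1, 1) + q (- 1, - 1) + q (1, - 1)"
    unfolding diamond_eq by (subst sum.distinct_set_conv_list) simp_all
  also have "\<dots> \<le> 8"
    by (rule arm_sum_le) (rule q0 q1 q2 q2' centre' east' west' north' south')+
  finally show ?thesis by simp
qed

lemma card_pairs_le:
  assumes c: "c \<in> C"
    and dist: "\<And>u v. diamond u \<inter> C = diamond v \<inter> C \<Longrightarrow> u = v"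
  shows "card {v \<in> diamond c. card (diamond v \<inter> C) = 2} \<le> 8" (is "card ?P \<le> 8")
proof -
  define P where "P = (\<lambda>v. v - c) ` ?P"
  have "card ?P = card P"
    unfolding P_def by (rule card_image[symmetric]) (simp add: inj_on_def)
  also have "\<dots> \<le> 8"
  proof (rule card_isolated_le)
    show "P \<subseteq> diamond (0, 0)"
      using diff_mem_diamond_diff[of _ c c] by (auto simp: P_def zero_prod_def)
    fix x assume "x \<in> P"
    then obtain v where v: "v \<in> ?P" and x: "x = v - c" by (auto simp: P_def)
    have pair: "\<exists>w. w \<noteq> c \<and> diamond u \<inter> C = {c, w}" if "u \<in> ?P" for u
    proof -
      have "c \<in> diamond u \<inter> C" using that c by (simp add: mem_diamond_commute)
      moreover have "card (diamond u \<inter> C) = 2" using that by simp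
      ultimately show ?thesis unfolding card_2_iff by (metis insert_commute insertE singletonD)
    qed
    obtain w where w: "w \<noteq> c" "diamond v \<inter> C = {c, w}" using pair[OF v] by blast
    \<comment> \<open>Such a \<open>u\<close> sees both \<open>c\<close> and \<open>w\<close>, hence
      nothing else, and so sees the same codewords as \<open>v\<close>.\<close>
    have only: "u = v" if u: "u \<in> ?P" "u \<in> diamond w" for u
    proof -
      have "w \<in> diamond u \<inter> C" using u w(2) by (auto simp: mem_diamond_commute)
      then have "diamond u \<inter> C = {c, w}" using pair[OF u(1)] w(1) by auto
      then show "u = v" using w(2) dist by metis
    qed
    have "v \<in> diamond w" using w(2) by (auto simp: mem_diamond_commute)
    then have "x \<in> diamond (w - c) \<inter> P"
      using v by (simp add: x P_def diff_mem_diamond_diff)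
    moreover have "y = x" if y: "y \<in> diamond (w - c) \<inter> P" for y
    proof -
      obtain u where u: "u \<in> ?P" "y = u - c" using y by (auto simp: P_def)
      then have "u \<in> diamond w" using y diff_mem_diamond_diff by blast
      then show "y = x" using only[OF u(1)] u(2) x by simp
    qed
    ultimately have "diamond (w - c) \<inter> P = {x}" by blast
    moreover have "w - c \<noteq> (0, 0)"
      using w(1) by (metis eq_iff_diff_eq_0 zero_prod_def)
    ultimately show "\<exists>w. w \<noteq> (0, 0) \<and> diamond w \<inter> P = {x}" by blast
  qed
  finally show ?thesis .
qed

section \<open>Double counting\<close>

text \<open>Both sides count the pairs of a vertex in \<open>S\<close> and a codeword near it;
  \<open>D\<close> is a finite stand-in for \<open>C\<close> holding all codewords seen from
  \<open>S\<close>.\<close>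

lemma sum_card_diamond_swap:
  assumes "finite S" "finite D" "D \<subseteq> C" "\<And>v. v \<in> S \<Longrightarrow> diamond v \<inter> C \<subseteq> D"
  shows "(\<Sum>v\<in>S. card (diamond v \<inter> C)) = (\<Sum>c\<in>D. card (S \<inter> diamond c))"
proof -
  have "(\<Sum>v\<in>S. card (diamond v \<inter> C)) = (\<Sum>v\<in>S. \<Sum>c | c \<in> D \<and> c \<in> diamond v. 1)"
  proof (rule sum.cong[OF refl])
    fix v assume "v \<in> S"
    then have "diamond v \<inter> C = {c. c \<in> D \<and> c \<in> diamond v}" using assms by blast
    then show "card (diamond v \<inter> C) = (\<Sum>c | c \<in> D \<and> c \<in> diamond v. 1)" by simp
  qed
  also have "\<dots> = (\<Sum>c\<in>D. \<Sum>v | v \<in> S \<and> c \<in> diamond v. 1)"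
    by (rule sum.swap_restrict) fact+
  also have "\<dots> = (\<Sum>c\<in>D. card (S \<inter> diamond c))"
    by (rule sum.cong[OF refl]) (simp add: Int_def mem_diamond_commute)
  finally show ?thesis .
qed

lemma card_le_card_code:
  assumes "finite Q" "finite D" "D \<subseteq> C"
    and D: "\<And>v. v \<in> Q \<Longrightarrow> diamond v \<inter> C \<subseteq> D"
    and ne: "\<And>v. diamond v \<inter> C \<noteq> {}"
    and dist: "\<And>u v. diamond u \<inter> C = diamond v \<inter> C \<Longrightarrow> u = v"
  shows "3 * card Q \<le> 19 * card D"
proof -
  let ?k = "\<lambda>v. card (diamond v \<inter> C)"
  define S1 where "S1 = {v \<in> Q. ?k v = 1}"
  define S2 where "S2 = {v \<in> Q. ?k v = 2}"
  \<comment> \<open>The indicator terms fill the deficit of vertices seeing one or two codewords; no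
    vertex sees none.\<close>
  have k_ge: "3 \<le> ?k v + 2 * of_bool (?k v = 1) + of_bool (?k v = 2)" for v
  proof -
    have "?k v \<noteq> 0" using ne[of v] finite_diamond[of v] by simp
    then show ?thesis by (auto simp: of_bool_def)
  qed
  have "card S1 \<le> card ((\<lambda>c. {c}) ` D)"
  proof (rule card_inj_on_le)
    show "inj_on (\<lambda>v. diamond v \<inter> C) S1" using dist by (auto simp: inj_on_def)
    show "(\<lambda>v. diamond v \<inter> C) ` S1 \<subseteq> (\<lambda>c. {c}) ` D"
      using D by (fastforce simp: S1_def card_1_singleton_iff)
  qed (use \<open>finite D\<close> in simp)
  then have S1: "card S1 \<le> card D"
    using card_image_le[OF \<open>finite D\<close>, of "\<lambda>c. {c}"] by linarith
  \<comment> \<open>Each vertex of \<open>S2\<close> is counted at both of its codewords, so 8 per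
    codeword becomes 4.\<close>
  have "2 * card S2 = (\<Sum>v\<in>S2. ?k v)" by (simp add: S2_def)
  also have "\<dots> = (\<Sum>c\<in>D. card (S2 \<inter> diamond c))"
    using assms by (intro sum_card_diamond_swap) (auto simp: S2_def)
  also have "\<dots> \<le> (\<Sum>c\<in>D. 8)"
  proof (rule sum_mono)
    fix c assume "c \<in> D"
    then have "card {v \<in> diamond c. ?k v = 2} \<le> 8"
      using \<open>D \<subseteq> C\<close> dist by (intro card_pairs_le) auto
    moreover have "card (S2 \<inter> diamond c) \<le> card {v \<in> diamond c. ?k v = 2}"
      by (rule card_mono) (auto simp: S2_def finite_diamond)
    ultimately show "card (S2 \<inter> diamond c) \<le> 8" by linarith
  qed
  finally have S2: "card S2 \<le> 4 * card D" by simp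
  have "(\<Sum>v\<in>Q. ?k v) = (\<Sum>c\<in>D. card (Q \<inter> diamond c))"
    using assms by (intro sum_card_diamond_swap)
  also have "\<dots> \<le> (\<Sum>c\<in>D. 13)"
    by (rule sum_mono) (metis card_diamond card_mono finite_diamond Int_lower2)
  finally have all: "(\<Sum>v\<in>Q. ?k v) \<le> 13 * card D" by simp
  have "3 * card Q \<le> (\<Sum>v\<in>Q. ?k v + 2 * of_bool (?k v = 1) + of_bool (?k v = 2))"
    using sum_mono[of Q "\<lambda>_. 3", OF k_ge] by (simp add: mult.commute)
  also have "\<dots> = (\<Sum>v\<in>Q. ?k v) + 2 * card S1 + card S2"
    using \<open>finite Q\<close> by (simp add: sum.distrib sum_distrib_left[symmetric] S1_def S2_def of_bool_def
        sum.If_cases Int_def)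
  finally show ?thesis using all S1 S2 by linarith
qed

section \<open>Density\<close>

lemma grid_square_eq: "grid_square m = {- int m..int m} \<times> {- int m..int m}"
  by (auto simp: grid_square_def)

lemma card_grid_square: "card (grid_square m) = (2 * m + 1)\<^sup>2"
proof -
  have "nat (int m - - int m + 1) = 2 * m + 1" by simp
  then show ?thesis by (simp only: grid_square_eq card_cartesian_product card_atLeastAtMost_int power2_eq_square)
qed

lemma diamond_subset_grid_square:
  assumes "v \<in> grid_square m"
  shows "diamond v \<subseteq> grid_square (m + 2)"
proof
  fix u assume "u \<in> diamond v"
  then have u: "\<bar>fst u - fst v\<bar> \<le> 2" "\<bar>snd u - snd v\<bar> \<le> 2"
    by (auto simp: diamond_def)
  have v: "\<bar>fst v\<bar> \<le> int m" "\<bar>snd v\<bar> \<le> int m"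
    using assms by (auto simp: grid_square_def)
  have "\<bar>fst u\<bar> \<le> int (m + 2)" using u(1) v(1) by linarith
  moreover have "\<bar>snd u\<bar> \<le> int (m + 2)" using u(2) v(2) by linarith
  ultimately show "u \<in> grid_square (m + 2)" by (simp add: grid_square_def case_prod_unfold)
qed

theorem theorem2:
  fixes C :: "(int \<times> int) set"
  assumes "identifying_code (with_proj square_grid) 2 C"
  shows "code_density C \<ge> ereal (3 / 19)"
proof -
  have ne: "\<And>v. diamond v \<inter> C \<noteq> {}"
    and dist: "\<And>u v. diamond u \<inter> C = diamond v \<inter> C \<Longrightarrow> u = v"
    using assms unfolding identifying_code_def graph_ball_square_grid with_proj_simps pverts_square_grid
    by blast+
  \<comment> \<open>The codewords in the square of radius \<open>m\<close> are compared with the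
    vertices in the square of radius \<open>m - 2\<close>, of which there are
    \<open>(2 * (m - 2) + 1)\<^sup>2\<close>: no vertex of the smaller square sees a codeword
    outside the larger. The margin vanishes in the limit.\<close>
  define g where "g m = 3 / 19 * (2 * real m - 3)\<^sup>2 / (2 * real m + 1)\<^sup>2" for m :: nat
  have g_le: "g m \<le> real (card (C \<inter> grid_square m)) / real (card (grid_square m))" if "2 \<le> m" for m
  proof -
    obtain n where m: "m = n + 2" using \<open>2 \<le> m\<close> by (metis le_add_diff_inverse2)
    have "3 * card (grid_square n) \<le> 19 * card (C \<inter> grid_square m)"
      using diamond_subset_grid_square[of _ n] ne dist
      by (intro card_le_card_code[of _ _ C]) (auto simp: m grid_square_eq)
    then have "3 * real (card (grid_square n)) \<le> 19 * real (card (C \<inter> grid_square m))"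
      by (metis of_nat_le_iff of_nat_mult of_nat_numeral)
    then have "3 / 19 * (2 * real m - 3)\<^sup>2 \<le> real (card (C \<inter> grid_square m))"
      by (simp add: card_grid_square m)
    moreover have "real (card (grid_square m)) = (2 * real m + 1)\<^sup>2"
      by (simp add: card_grid_square add.commute)
    ultimately show ?thesis
      by (simp only: g_def divide_right_mono zero_le_power2)
  qed
  have "g \<longlonglongrightarrow> 3 / 19" unfolding g_def by real_asymp
  then have "limsup (\<lambda>m. ereal (g m)) = ereal (3 / 19)"
    by (intro lim_imp_Limsup) simp_all
  \<comment> \<open>The bound by \<open>g\<close> starts at \<open>m = 2\<close>, which suffices for
    a limsup.\<close>
  moreover have "limsup (\<lambda>m. ereal (g m)) \<le> code_density C"
    unfolding code_density_def using g_le
    by (intro Limsup_mono eventually_sequentiallyI[of 2]) simp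
  ultimately show ?thesis by simp
qed

end
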